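(* Let $j\ge1$ and $k\ge 1$ be integers. (a) For every squarefree integer $n\ge1$, $$E^{*}_{j,k}(n)\le k\Bigl(\frac{j+2}{2^{\frac{2}{j+2}}}\Bigr)^{\omega(n)}.$$ (b) For every integer $n\ge1$, $$E_{j,k}(n)\le k\prod_{p^v\| n}\bigl((j+1)v^{\frac{j}{j+1}}\bigr).$$
   Context: For an integer $n\ge1$, $\mathcal{D}_n$ denotes the set of positive divisors of $n$, and $\omega(n)$ the number of distinct prime factors of $n$. A set $U\subseteq\mathcal{D}_n^j$ is called regular if every tuple in $U$ has pairwise coprime entries. For an integer $k\ge1$, a map $g:U_g\to\mathcal{D}_n$ defined on a regular set $U_g\subseteq \mathcal{D}_n^j$ is called $k$-regular if (0) for every $(d_1,\dots,d_j)\in U_g$ one has $\gcd(g(d_1,\dots,d_j),d_i)=1$ for each $i$; (1) for each $1\le i\le j$ and each fixed choice of the other coordinates $d_1,\dots,d_{i-1},d_{i+1},\dots,d_j$ and of $d$, the equation $g(d_1,\dots,d_{i-1},z,d_{i+1},\dots,d_j)=d$ has at most $k$ solutions $z$ with the tuple in $U_g$; (2) under the same fixing, the equation $z\,g(d_1,\dots,d_{i-1},z,d_{i+1},\dots,d_j)=d$ has at most $k$ solutions $z$ with the tuple in $U_g$. The map is strongly $k$-regular if moreover (3) for each $1\le i_1<i_2\le j$ and each fixed choice of all other coordinates and of $d,d'$, the system $g(\dots,z_1,\dots,z_2,\dots)=d$, $z_1z_2=d'$ (with $z_1,z_2$ in positions $i_1,i_2$) has at most $k$ solutions $(z_1,z_2)$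 with the tuple in $U_g$. $E_{j,k}(n)$ (resp. $E^*_{j,k}(n)$) is the maximum of $|U_g|$ over all $k$-regular (resp. strongly $k$-regular) maps $g$. *)

theory Defs
  imports Complex_Main "HOL-Computational_Algebra.Squarefree"
begin

definition divisors :: "nat \<Rightarrow> nat set" where
  "divisors n = {d. 0 < d \<and> d dvd n}"

(* A j-tuple (d_1, ..., d_j) is a list of length j, so d_i is ds ! (i - 1). *)

definition divisor_tuples :: "nat \<Rightarrow> nat \<Rightarrow> nat list set" where
  "divisor_tuples n j = {ds. length ds = j \<and> set ds \<subseteq> divisors n}"

definition regular_set :: "nat \<Rightarrow> nat \<Rightarrow> nat list set \<Rightarrow> bool" where
  "regular_set n j U \<longleftrightarrow>
     U \<subseteq> divisor_tuples n j \<and>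
     (\<forall>ds\<in>U. \<forall>i<j. \<forall>i'<j. i \<noteq> i' \<longrightarrow> coprime (ds ! i) (ds ! i'))"

(* A map from U to the divisors of n is a total function of which only the values on U matter.
   Fixing all coordinates but the i-th one amounts to fixing ds and considering the
   tuples ds[i := z]; the entry ds ! i is irrelevant. For n > 0 all solution sets below are finite,
   because every solution is a divisor of n, so that card really counts the solutions. *)

definition k_regular :: "nat \<Rightarrow> nat \<Rightarrow> nat \<Rightarrow> nat list set \<Rightarrow> (nat list \<Rightarrow> nat) \<Rightarrow> bool" where
  "k_regular n j k U g \<longleftrightarrow>
     regular_set n j U \<and>
     (\<forall>ds\<in>U. g ds \<in> divisors n) \<and>
     (\<forall>ds\<in>U. \<forall>i<j. gcd (g ds) (ds ! i) = 1) \<and>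
     (\<forall>i<j. \<forall>ds\<in>divisor_tuples n j. \<forall>d.
        card {z. ds[i := z] \<in> U \<and> g (ds[i := z]) = d} \<le> k) \<and>
     (\<forall>i<j. \<forall>ds\<in>divisor_tuples n j. \<forall>d.
        card {z. ds[i := z] \<in> U \<and> z * g (ds[i := z]) = d} \<le> k)"

definition strongly_k_regular ::
    "nat \<Rightarrow> nat \<Rightarrow> nat \<Rightarrow> nat list set \<Rightarrow> (nat list \<Rightarrow> nat) \<Rightarrow> bool" where
  "strongly_k_regular n j k U g \<longleftrightarrow>
     k_regular n j k U g \<and>
     (\<forall>i\<^sub>1 i\<^sub>2. i\<^sub>1 < i\<^sub>2 \<and> i\<^sub>2 < j \<longrightarrow>
        (\<forall>ds\<in>divisor_tuples n j. \<forall>d d'.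
           card {(z\<^sub>1, z\<^sub>2). ds[i\<^sub>1 := z\<^sub>1, i\<^sub>2 := z\<^sub>2] \<in> U \<and>
                   g (ds[i\<^sub>1 := z\<^sub>1, i\<^sub>2 := z\<^sub>2]) = d \<and> z\<^sub>1 * z\<^sub>2 = d'} \<le> k))"

definition E :: "nat \<Rightarrow> nat \<Rightarrow> nat \<Rightarrow> nat" where
  "E j k n = Max {card U | U. \<exists>g. k_regular n j k U g}"

definition E_star :: "nat \<Rightarrow> nat \<Rightarrow> nat \<Rightarrow> nat" where
  "E_star j k n = Max {card U | U. \<exists>g. strongly_k_regular n j k U g}"

definition omega :: "nat \<Rightarrow> nat" where
  "omega n = card (prime_factors n)"

(* The two maxima exist. *)

lemma finite_divisor_tuples:
  assumes "n > 0"
  shows "finite (divisor_tuples n j)"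
proof -
  have "finite (divisors n)"
    unfolding divisors_def by (rule finite_subset[OF _ finite_divisors_nat[OF assms]]) blast
  then show ?thesis
    unfolding divisor_tuples_def by (rule rev_finite_subset[OF finite_lists_length_eq[where n = j]]) blast
qed

lemma k_regularD_subset:
  assumes "k_regular n j k U g"
  shows "U \<subseteq> divisor_tuples n j"
  using assms unfolding k_regular_def regular_set_def by (elim conjE)

lemma strongly_k_regularD:
  assumes "strongly_k_regular n j k U g"
  shows "k_regular n j k U g"
  using assms unfolding strongly_k_regular_def by (elim conjE)

lemma strongly_k_regular_empty: "strongly_k_regular n j k {} g"
  by (simp add: strongly_k_regular_def k_regular_def regular_set_def)

lemma finite_E_set:
  assumes "n > 0"
  shows "finite {card U | U. \<exists>g. k_regular n j k U g}"
proof (rule finite_subset)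
  show "{card U | U. \<exists>g. k_regular n j k U g} \<subseteq> card ` Pow (divisor_tuples n j)"
    by (auto dest!: k_regularD_subset)
  show "finite (card ` Pow (divisor_tuples n j))"
    by (simp add: finite_divisor_tuples[OF assms])
qed

lemma finite_E_star_set:
  assumes "n > 0"
  shows "finite {card U | U. \<exists>g. strongly_k_regular n j k U g}"
  by (rule finite_subset[OF _ finite_E_set[OF assms]]) (blast dest: strongly_k_regularD)

lemma E_star_set_nonempty: "{card U | U. \<exists>g. strongly_k_regular n j k U g} \<noteq> {}"
  by (blast intro: strongly_k_regular_empty)

lemma E_set_nonempty: "{card U | U. \<exists>g. k_regular n j k U g} \<noteq> {}"
  by (blast intro: strongly_k_regular_empty strongly_k_regularD)

end

theory Submission
  imports Defs "HOL-Analysis.Convex"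
begin

text \<open>Since the entries of the extended tuple (d_1, ..., d_j, g(d_1, ..., d_j)) are pairwise coprime
  divisors of n, the tuple is the same thing as an assignment to each prime p of n of the
  position (slot) of the entry it divides, or of the extra slot j + 1 if there is none, together with
  an exponent. Regularity says that certain projections of these assignments have fibers of at most k
  elements. Weighting the values of each projection by a product over the primes bounds a weighted
  sum over U, and averaging over the projections with AM-GM bounds the cardinality of U.

  For (a), projections merge cyclically consecutive slots c and c + 1 (mod j + 2), the merged slot
  having weight 2: the total weight at each prime is j + 2, and the geometric mean of the weights is
  the (j + 2)-th root of 4, because every slot takes part in two merges. For (b), projections forget
  one of the j + 1 entries; with v the exponent of p in n, the optimal weights are v^(j/(j+1)) for no
  remaining entry and v^(-1/(j+1)) otherwise.\<close>

section \<open>Weighted counting through projections with small fibers\<close>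

text \<open>Grouping S by the family of values \<open>f x p\<close>, each family occurs at most k
  times. Enlarging the sum to all families in the product of the sets \<open>T p\<close> only adds
  nonnegative terms, and that full sum factors over the primes by distributivity.\<close>

lemma sum_prod_le_of_fibers:
  fixes h :: "'p \<Rightarrow> 't \<Rightarrow> real"
  assumes fin: "finite S" "finite P" "\<And>p. p \<in> P \<Longrightarrow> finite (T p)"
    and maps: "\<And>x p. x \<in> S \<Longrightarrow> p \<in> P \<Longrightarrow> f x p \<in> T p"
    and fibers: "\<And>x. x \<in> S \<Longrightarrow> card {y \<in> S. \<forall>p\<in>P. f y p = f x p} \<le> k"
    and nonneg: "\<And>p t. p \<in> P \<Longrightarrow> h p t \<ge> 0"
  shows "(\<Sum>x\<in>S. \<Prod>p\<in>P. h p (f x p)) \<le> real k * (\<Prod>p\<in>P. \<Sum>t\<in>T p. h p t)"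
proof -
  \<comment> \<open>Restriction to P makes equality of functions the same as agreement on P, so that
    the fibers of \<open>F\<close> are the sets bounded by k.\<close>
  define F where "F x = restrict (f x) P" for x
  define w where "w g = (\<Prod>p\<in>P. h p (g p))" for g
  have w_nonneg: "w g \<ge> 0" for g
    unfolding w_def by (intro prod_nonneg) (use nonneg in auto)
  have F_in: "F ` S \<subseteq> PiE P T"
    using maps by (auto simp: F_def)
  have F_eq: "F y = F x \<longleftrightarrow> (\<forall>p\<in>P. f y p = f x p)" for x y
    by (auto simp: F_def fun_eq_iff restrict_def)
  have fin_PiE: "finite (PiE P T)"
    using fin by (intro finite_PiE) auto
  have "(\<Sum>x\<in>S. \<Prod>p\<in>P. h p (f x p)) = (\<Sum>x\<in>S. w (F x))"
    by (simp add: w_def F_def)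
  also have "\<dots> = (\<Sum>y\<in>F ` S. of_nat (card {x \<in> S. F x = y}) * w y)"
    using sum_fun_comp[of S "F ` S" F w] fin(1) by auto
  also have "\<dots> \<le> (\<Sum>y\<in>F ` S. real k * w y)"
    using fibers w_nonneg by (intro sum_mono mult_right_mono) (auto simp: F_eq)
  also have "\<dots> \<le> (\<Sum>y\<in>PiE P T. real k * w y)"
    using F_in fin_PiE w_nonneg by (intro sum_mono2) auto
  also have "\<dots> = real k * (\<Prod>p\<in>P. \<Sum>t\<in>T p. h p t)"
    unfolding w_def using fin by (subst prod_sum_PiE) (auto simp: sum_distrib_left)
  finally show ?thesis .
qed

text \<open>The geometric mean over i of the products of the weights h i is at least the product of
  the b p at every point of S, hence so is their arithmetic mean, whose total mass over S is
  controlled by the fibers.\<close>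

lemma card_le_of_weighted_fibers:
  fixes h :: "'i \<Rightarrow> 'p \<Rightarrow> 't \<Rightarrow> real" and b C :: "'p \<Rightarrow> real"
  assumes fin: "finite S" "finite P" "finite I" "I \<noteq> {}"
      "\<And>i p. i \<in> I \<Longrightarrow> p \<in> P \<Longrightarrow> finite (T i p)"
    and maps: "\<And>i x p. i \<in> I \<Longrightarrow> x \<in> S \<Longrightarrow> p \<in> P \<Longrightarrow> f i x p \<in> T i p"
    and fibers: "\<And>i x. i \<in> I \<Longrightarrow> x \<in> S \<Longrightarrow> card {y \<in> S. \<forall>p\<in>P. f i y p = f i x p} \<le> k"
    and nonneg: "\<And>i p t. i \<in> I \<Longrightarrow> p \<in> P \<Longrightarrow> h i p t \<ge> 0" "\<And>p. p \<in> P \<Longrightarrow> b p \<ge> 0"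
    and total: "\<And>i p. i \<in> I \<Longrightarrow> p \<in> P \<Longrightarrow> (\<Sum>t\<in>T i p. h i p t) = C p"
    and lower: "\<And>x p. x \<in> S \<Longrightarrow> p \<in> P \<Longrightarrow> b p ^ card I \<le> (\<Prod>i\<in>I. h i p (f i x p))"
  shows "real (card S) * (\<Prod>p\<in>P. b p) \<le> real k * (\<Prod>p\<in>P. C p)"
proof -
  define r where "r = real (card I)"
  have r: "r > 0" "card I > 0"
    using fin by (auto simp: r_def card_gt_0_iff)
  define H where "H i x = (\<Prod>p\<in>P. h i p (f i x p))" for i x
  have H_nonneg: "H i x \<ge> 0" if "i \<in> I" for i x
    unfolding H_def using that nonneg by (intro prod_nonneg) auto
  have "(\<Prod>p\<in>P. b p) * r \<le> (\<Sum>i\<in>I. H i x)" if x: "x \<in> S" for x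
  proof -
    have "(\<Prod>p\<in>P. b p) ^ card I = (\<Prod>p\<in>P. b p ^ card I)"
      by (simp add: prod_power_distrib)
    also have "\<dots> \<le> (\<Prod>p\<in>P. \<Prod>i\<in>I. h i p (f i x p))"
      using x nonneg lower by (intro prod_mono) auto
    also have "\<dots> = (\<Prod>i\<in>I. H i x)"
      unfolding H_def by (rule prod.swap)
    finally have "(\<Prod>p\<in>P. b p) ^ card I \<le> (\<Prod>i\<in>I. H i x)" .
    then have "root (card I) ((\<Prod>p\<in>P. b p) ^ card I) \<le> root (card I) (\<Prod>i\<in>I. H i x)"
      using r by simp
    moreover have "root (card I) ((\<Prod>p\<in>P. b p) ^ card I) = (\<Prod>p\<in>P. b p)"
      using r nonneg by (intro real_root_power_cancel prod_nonneg) auto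
    moreover have "root (card I) (\<Prod>i\<in>I. H i x) \<le> (\<Sum>i\<in>I. H i x / card I)"
      using arith_geom_mean[of I "\<lambda>i. H i x"] fin r H_nonneg
      by (subst root_powr_inverse) (auto intro!: prod_nonneg)
    ultimately have "(\<Prod>p\<in>P. b p) \<le> (\<Sum>i\<in>I. H i x) / r"
      by (simp add: r_def sum_divide_distrib)
    then show ?thesis using r by (simp add: field_simps)
  qed
  then have "(\<Sum>x\<in>S. (\<Prod>p\<in>P. b p) * r) \<le> (\<Sum>x\<in>S. \<Sum>i\<in>I. H i x)"
    by (rule sum_mono)
  also have "\<dots> = (\<Sum>i\<in>I. \<Sum>x\<in>S. H i x)"
    by (rule sum.swap)
  also have "\<dots> \<le> (\<Sum>i\<in>I. real k * (\<Prod>p\<in>P. C p))"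
  proof (rule sum_mono)
    fix i assume i: "i \<in> I"
    have "(\<Sum>x\<in>S. H i x) \<le> real k * (\<Prod>p\<in>P. \<Sum>t\<in>T i p. h i p t)"
      unfolding H_def using i fin maps fibers nonneg by (intro sum_prod_le_of_fibers) auto
    also have "(\<Prod>p\<in>P. \<Sum>t\<in>T i p. h i p t) = (\<Prod>p\<in>P. C p)"
      using i total by (intro prod.cong) auto
    finally show "(\<Sum>x\<in>S. H i x) \<le> real k * (\<Prod>p\<in>P. C p)" .
  qed
  finally have "(real (card S) * (\<Prod>p\<in>P. b p)) * r \<le> (real k * (\<Prod>p\<in>P. C p)) * r"
    by (simp add: r_def mult_ac)
  then show ?thesis using r by simp
qed

section \<open>Encoding pairwise coprime lists by slots and exponents\<close>

text \<open>The default \<open>length es\<close> stands for a prime that divides no entry. Indices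
  start at 0, so once the value of g is appended to a j-tuple, the entries are slots 0 to j - 1, the
  value is slot j and absence is slot j + 1.\<close>

definition slot :: "nat list \<Rightarrow> nat \<Rightarrow> nat" where
  "slot es p = (LEAST i. i = length es \<or> p dvd es ! i)"

definition coprime_list :: "nat list \<Rightarrow> bool" where
  "coprime_list es \<longleftrightarrow> (\<forall>i<length es. \<forall>i'<length es. i \<noteq> i' \<longrightarrow> coprime (es ! i) (es ! i'))"

lemma slot_le: "slot es p \<le> length es"
  unfolding slot_def by (rule Least_le) simp

lemma slot_dvd: "slot es p < length es \<Longrightarrow> p dvd es ! slot es p"
  using LeastI[of "\<lambda>i. i = length es \<or> p dvd es ! i" "length es"] by (auto simp: slot_def)

text \<open>A prime divides at most one entry of a pairwise coprime list, so the least index found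
  is the only one.\<close>

lemma slot_eq_iff:
  assumes "coprime_list es" "prime p" "i < length es"
  shows "slot es p = i \<longleftrightarrow> p dvd es ! i"
proof
  show "slot es p = i \<Longrightarrow> p dvd es ! i"
    using slot_dvd[of es p] assms(3) by auto
next
  assume dvd: "p dvd es ! i"
  then have "slot es p \<le> i"
    unfolding slot_def by (intro Least_le) simp
  then have "slot es p < length es" using assms(3) by simp
  then have "p dvd es ! slot es p" by (rule slot_dvd)
  with dvd show "slot es p = i"
    using assms \<open>slot es p < length es\<close> unfolding coprime_list_def
    by (metis coprime_common_divisor_nat not_prime_1)
qed

text \<open>Multiplicities in a squarefree number are 0 or 1, and primes outside n divide neither a
  nor b. This recovers single entries, and also products of two merged entries, from slots
  alone.\<close>

lemma eq_of_prime_factors_of_squarefree: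
  fixes a b n :: nat
  assumes "squarefree a" "squarefree b" "a dvd n" "b dvd n" "n > 0"
    and "\<And>p. p \<in> prime_factors n \<Longrightarrow> p dvd a \<longleftrightarrow> p dvd b"
  shows "a = b"
proof (rule multiplicity_eq_nat)
  show pos: "a > 0" "b > 0" using assms by (auto intro: Nat.gr0I)
  fix p :: nat assume p: "prime p"
  have sq: "multiplicity p x = (if p dvd x then 1 else 0)" if "squarefree x" "x > 0" for x
    using that p squarefree_factorial_semiring''[of x] prime_multiplicity_gt_zero_iff[of p x]
    by (auto simp: not_dvd_imp_multiplicity_0 le_antisym prime_gt_0_nat Suc_leI)
  have "p dvd a \<longleftrightarrow> p dvd b"
    using assms(3-6) p by (metis dvd_trans in_prime_factors_iff not_gr_zero)
  then show "multiplicity p a = multiplicity p b"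
    using sq assms(1,2) pos by simp
qed

lemma eq_of_multiplicity_eq:
  fixes a b n :: nat
  assumes "a dvd n" "b dvd n" "n > 0"
    and "\<And>p. p \<in> prime_factors n \<Longrightarrow> multiplicity p a = multiplicity p b"
  shows "a = b"
proof (rule multiplicity_eq_nat)
  show "a > 0" "b > 0" using assms by (auto intro: Nat.gr0I)
  fix p :: nat assume p: "prime p"
  show "multiplicity p a = multiplicity p b"
  proof (cases "p dvd n")
    case True
    then show ?thesis using p assms by (simp add: in_prime_factors_iff)
  next
    case False
    then show ?thesis using assms(1,2)
      by (metis dvd_trans not_dvd_imp_multiplicity_0)
  qed
qed

section \<open>Fibers controlled by regularity\<close>

text \<open>Appending \<open>g ds\<close> at index j turns coprimality of the tuple and coprimality
  of the value to the tuple into one symmetric condition on a list of length j + 1.\<close>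

lemma k_regularD:
  assumes "k_regular n j k U g" "n > 0"
  shows k_regular_finite: "finite U"
    and k_regular_length: "ds \<in> U \<Longrightarrow> length ds = j"
    and k_regular_nth_divisors: "ds \<in> U \<Longrightarrow> i < j \<Longrightarrow> ds ! i \<in> divisors n"
    and k_regular_dvd: "ds \<in> U \<Longrightarrow> i \<le> j \<Longrightarrow> (ds @ [g ds]) ! i dvd n"
    and k_regular_coprime_list: "ds \<in> U \<Longrightarrow> coprime_list (ds @ [g ds])"
proof -
  have U: "U \<subseteq> divisor_tuples n j" using assms(1) by (rule k_regularD_subset)
  then show "finite U" by (rule finite_subset) (rule finite_divisor_tuples[OF assms(2)])
  assume ds: "ds \<in> U"
  show len: "length ds = j" using U ds by (auto simp: divisor_tuples_def)
  show nth: "ds ! i \<in> divisors n" if "i < j" for i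
    using U ds len that by (fastforce simp: divisor_tuples_def)
  have g: "g ds \<in> divisors n" and g_coprime: "\<And>i. i < j \<Longrightarrow> coprime (g ds) (ds ! i)"
    using assms(1) ds by (auto simp: k_regular_def coprime_iff_gcd_eq_1)
  show "(ds @ [g ds]) ! i dvd n" if "i \<le> j"
    using nth g len that by (auto simp: nth_append divisors_def)
  have "coprime (ds ! i) (ds ! i')" if "i < j" "i' < j" "i \<noteq> i'" for i i'
    using assms(1) ds that by (auto simp: k_regular_def regular_set_def)
  then show "coprime_list (ds @ [g ds])"
    using g_coprime len
    by (auto simp: coprime_list_def nth_append less_Suc_eq coprime_commute)
qed

lemma card_le_of_image:
  assumes "A \<subseteq> h ` Z" "finite Z" "card Z \<le> k"
  shows "card A \<le> k"
  using surj_card_le[OF assms(2,1)] assms(3) by simp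

text \<open>Every y in A equals \<open>x[i := y ! i]\<close>, so A is the image of a solution set in
  the single unknown z. The two alternatives for g match the two solution bounds in
  \<open>k_regular\<close>.\<close>

lemma card_fiber_entry:
  assumes reg: "k_regular n j k U g" "n > 0" and x: "x \<in> U" and i: "i < j"
    and A: "A \<subseteq> U" "\<And>y l. y \<in> A \<Longrightarrow> l < j \<Longrightarrow> l \<noteq> i \<Longrightarrow> y ! l = x ! l"
    and g: "(\<forall>y\<in>A. g y = g x) \<or> (\<forall>y\<in>A. y ! i * g y = x ! i * g x)"
  shows "card A \<le> k"
proof -
  have x': "x \<in> divisor_tuples n j" "length x = j"
    using x k_regularD_subset[OF reg(1)] k_regular_length[OF reg] by auto
  have y: "x[i := y ! i] = y" if "y \<in> A" for y
    using that A x' i k_regular_length[OF reg, of y]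
    by (intro nth_equalityI) (auto simp: nth_list_update)
  have fin: "finite (divisors n)"
    unfolding divisors_def by (rule finite_subset[OF _ finite_divisors_nat[OF reg(2)]]) blast
  \<comment> \<open>Finiteness of the solution sets has to be secured, since \<open>card\<close> is
    0 on infinite sets and a bound on it would then say nothing.\<close>
  have Z: "{z. x[i := z] \<in> U \<and> Q z} \<subseteq> divisors n" for Q
    using k_regular_nth_divisors[OF reg _ i] x' i by fastforce
  show ?thesis
    using g
  proof
    assume g: "\<forall>y\<in>A. g y = g x"
    show ?thesis
    proof (rule card_le_of_image)
      let ?Z = "{z. x[i := z] \<in> U \<and> g (x[i := z]) = g x}"
      show "A \<subseteq> (\<lambda>z. x[i := z]) ` ?Z"
      proof
        fix y assume "y \<in> A"
        then show "y \<in> (\<lambda>z. x[i := z]) ` ?Z"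
          using A g y by (intro image_eqI[of _ _ "y ! i"]) auto
      qed
      show "finite ?Z" using Z fin by (rule finite_subset)
      show "card ?Z \<le> k" using reg(1) i x' unfolding k_regular_def by blast
    qed
  next
    assume g: "\<forall>y\<in>A. y ! i * g y = x ! i * g x"
    show ?thesis
    proof (rule card_le_of_image)
      let ?Z = "{z. x[i := z] \<in> U \<and> z * g (x[i := z]) = x ! i * g x}"
      show "A \<subseteq> (\<lambda>z. x[i := z]) ` ?Z"
      proof
        fix y assume "y \<in> A"
        then show "y \<in> (\<lambda>z. x[i := z]) ` ?Z"
          using A g y by (intro image_eqI[of _ _ "y ! i"]) auto
      qed
      show "finite ?Z" using Z fin by (rule finite_subset)
      show "card ?Z \<le> k" using reg(1) i x' unfolding k_regular_def by blast
    qed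
  qed
qed

text \<open>The analogue for two unknown entries with known product and known value of g, resting on
  the additional condition in \<open>strongly_k_regular\<close>.\<close>

lemma card_fiber_two_entries:
  assumes reg: "strongly_k_regular n j k U g" "n > 0" and x: "x \<in> U" and i: "a < b" "b < j"
    and A: "A \<subseteq> U" "\<And>y l. y \<in> A \<Longrightarrow> l < j \<Longrightarrow> l \<noteq> a \<Longrightarrow> l \<noteq> b \<Longrightarrow> y ! l = x ! l"
    and g: "\<And>y. y \<in> A \<Longrightarrow> g y = g x" "\<And>y. y \<in> A \<Longrightarrow> y ! a * y ! b = x ! a * x ! b"
  shows "card A \<le> k"
proof -
  note reg' = strongly_k_regularD[OF reg(1)] reg(2)
  have x': "x \<in> divisor_tuples n j" "length x = j"
    using x k_regularD_subset[OF reg'(1)] k_regular_length[OF reg'] by auto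
  have y: "x[a := y ! a, b := y ! b] = y" if "y \<in> A" for y
    using that A x' i k_regular_length[OF reg', of y]
    by (intro nth_equalityI) (auto simp: nth_list_update)
  have fin: "finite (divisors n)"
    unfolding divisors_def by (rule finite_subset[OF _ finite_divisors_nat[OF reg(2)]]) blast
  show ?thesis
  proof (rule card_le_of_image)
    let ?Z = "{(z, z'). x[a := z, b := z'] \<in> U \<and>
                   g (x[a := z, b := z']) = g x \<and> z * z' = x ! a * x ! b}"
    show "A \<subseteq> (\<lambda>(z, z'). x[a := z, b := z']) ` ?Z"
    proof
      fix y assume "y \<in> A"
      then show "y \<in> (\<lambda>(z, z'). x[a := z, b := z']) ` ?Z"
        using A g y by (intro image_eqI[of _ _ "(y ! a, y ! b)"]) auto
    qed
    have "z \<in> divisors n \<and> z' \<in> divisors n" if "x[a := z, b := z'] \<in> U" for z z'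
      using k_regular_nth_divisors[OF reg' that, of a] k_regular_nth_divisors[OF reg' that, of b]
        x' i by auto
    then have "?Z \<subseteq> divisors n \<times> divisors n" by auto
    then show "finite ?Z" by (rule finite_subset) (use fin in simp)
    show "card ?Z \<le> k" using reg(1) i x' unfolding strongly_k_regular_def by blast
  qed
qed

section \<open>The bound for k-regular maps: forgetting one entry\<close>

lemma k_regular_card_le:
  assumes reg: "k_regular n j k U g" and n: "n > 0" and k: "k \<ge> 1"
  shows "real (card U) \<le> real k * (\<Prod>p\<in>prime_factors n.
           (real j + 1) * real (multiplicity p n) powr (real j / (real j + 1)))"
proof -
  define es where "es x = x @ [g x]" for x
  define v where "v p = real (multiplicity p n)" for p
  \<comment> \<open>Forgetting entry i makes a prime in slot i indistinguishable from an absent one.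
    Both get the dummy exponent 0, so they share one value.\<close>
  define f where "f i x p = (if slot (es x) p \<in> {i, j + 1} then (j + 1, 0)
      else (slot (es x) p, multiplicity p (es x ! slot (es x) p)))" for i x p
  \<comment> \<open>Let A be the weight of absence and B that of any other value. A slot at most j
    is forgotten by exactly one of the j + 1 projections, which leads to the constraint A * B ^ j =
    1. The total A + j * v * B is then least when A = v * B, which gives these exponents.\<close>
  define h where "h p t = (if fst t = j + 1 then v p powr (real j / (real j + 1))
      else v p powr (- 1 / (real j + 1)))" for p and t :: "nat \<times> nat"
  define T where "T i p = insert (j + 1, 0) (({..j} - {i}) \<times> {1..multiplicity p n})" for i p
  have len: "length (es x) = j + 1" and cop: "coprime_list (es x)"
    and dvd: "\<And>l. l \<le> j \<Longrightarrow> es x ! l dvd n" if "x \<in> U" for x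
    using that k_regularD[OF reg n] by (simp_all add: es_def)
  have v: "v p \<ge> 1" if "p \<in> prime_factors n" for p
    using that n by (auto simp: v_def prime_factors_multiplicity)
  have slot_le: "slot (es x) p \<le> j + 1" if "x \<in> U" for x p
    using slot_le[of "es x" p] len[OF that] by simp
  \<comment> \<open>The slot and the exponent there determine the exponents of p in all entries. The
    right-hand side reads \<open>es x\<close> at the slot only when that slot is l, hence within
    range.\<close>
  have mult: "multiplicity p (es x ! l) =
      (if slot (es x) p = l then multiplicity p (es x ! slot (es x) p) else 0)"
    if "x \<in> U" "p \<in> prime_factors n" "l \<le> j" for x p l
    using that cop len slot_eq_iff[of "es x" p l]
    by (auto simp: in_prime_factors_iff not_dvd_imp_multiplicity_0)
  have entry_eq: "es y ! l = es x ! l"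
    if x: "x \<in> U" and y: "y \<in> U" and eq: "\<forall>p\<in>prime_factors n. f i y p = f i x p"
      and l: "l \<le> j" "l \<noteq> i" for x y i l
  proof (rule eq_of_multiplicity_eq[OF dvd dvd n])
    fix p assume p: "p \<in> prime_factors n"
    show "multiplicity p (es y ! l) = multiplicity p (es x ! l)"
      using bspec[OF eq p] l unfolding mult[OF x p l(1)] mult[OF y p l(1)]
      by (auto simp: f_def split: if_splits)
  qed (use x y l in auto)
  \<comment> \<open>The weights are normalised so that the pointwise lower bound \<open>b\<close> is
    1, and the left-hand side is just the cardinality.\<close>
  have "real (card U) * (\<Prod>p\<in>prime_factors n. 1) \<le> real k *
      (\<Prod>p\<in>prime_factors n. (real j + 1) * v p powr (real j / (real j + 1)))"
  proof (rule card_le_of_weighted_fibers[where I = "{..j}" and f = f and T = T and h = "\<lambda>_. h"])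
    show "finite U" by (rule k_regular_finite[OF reg n])
    show "finite (T i p)" for i p by (simp add: T_def)
  next
    fix i x p assume "i \<in> {..j}" and x: "x \<in> U" and p: "p \<in> prime_factors n"
    show "f i x p \<in> T i p"
    proof (cases "slot (es x) p \<in> {i, j + 1}")
      case True
      then show ?thesis by (auto simp: f_def T_def)
    next
      case False
      with slot_le[OF x, of p] have le: "slot (es x) p \<le> j" by auto
      have "p dvd es x ! slot (es x) p" using le len[OF x] by (intro slot_dvd) simp
      moreover have "es x ! slot (es x) p dvd n" using dvd[OF x le] .
      ultimately have "multiplicity p (es x ! slot (es x) p) \<in> {1..multiplicity p n}"
        using p n prime_multiplicity_gt_zero_iff[of p "es x ! slot (es x) p"]
        by (auto simp: in_prime_factors_iff Suc_le_eq dvd_imp_multiplicity_le)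
      then show ?thesis using False le by (auto simp: f_def T_def)
    qed
  next
    fix i x assume i: "i \<in> {..j}" and x: "x \<in> U"
    define A where "A = {y \<in> U. \<forall>p\<in>prime_factors n. f i y p = f i x p}"
    have A: "A \<subseteq> U" and eqA: "\<And>y l. y \<in> A \<Longrightarrow> l \<le> j \<Longrightarrow> l \<noteq> i \<Longrightarrow> es y ! l = es x ! l"
      using entry_eq[OF x] by (auto simp: A_def)
    have lens: "length y = j" if "y \<in> U" for y using k_regular_length[OF reg n that] .
    have nth: "y ! l = x ! l" if "y \<in> A" "l < j" "l \<noteq> i" for y l
      using eqA[of y l] that lens[of y] lens[of x] A x by (auto simp: es_def nth_append)
    \<comment> \<open>Forgetting the value of g (i = j) leaves the whole tuple, so the fiber is a
      singleton. Forgetting an entry keeps g and all other entries, which is the case of the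
      equation g = d in one unknown.\<close>
    have "card A \<le> k"
    proof (cases "i = j")
      case True
      have "A \<subseteq> {x}"
      proof
        fix y assume "y \<in> A"
        then have "y = x" using nth[of y] True lens[of y] lens[of x] A x
          by (intro nth_equalityI) auto
        then show "y \<in> {x}" by simp
      qed
      then have "card A \<le> card {x}" by (intro card_mono) auto
      then show ?thesis using k by simp
    next
      case False
      then have ij: "i < j" using i by auto
      have "g y = g x" if "y \<in> A" for y
        using eqA[of y j] that False lens[of y] lens[of x] A x by (auto simp: es_def nth_append)
      then show ?thesis using card_fiber_entry[OF reg n x ij A nth] by blast
    qed
    then show "card {y \<in> U. \<forall>p\<in>prime_factors n. f i y p = f i x p} \<le> k" by (simp add: A_def)
  next
    show "h p t \<ge> 0" for p t by (simp add: h_def)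
  next
    fix i p assume i: "i \<in> {..j}" and p: "p \<in> prime_factors n"
    have "(\<Sum>t\<in>T i p. h p t) = h p (j + 1, 0) + (\<Sum>t\<in>({..j} - {i}) \<times> {1..multiplicity p n}. h p t)"
      unfolding T_def by (subst sum.insert) auto
    also have "(\<Sum>t\<in>({..j} - {i}) \<times> {1..multiplicity p n}. h p t) =
        (\<Sum>t\<in>({..j} - {i}) \<times> {1..multiplicity p n}. v p powr (- 1 / (real j + 1)))"
      by (intro sum.cong) (auto simp: h_def)
    \<comment> \<open>Each of the j remaining slots admits v exponents and contributes v * v powr
      (-1/(j+1)), which equals the weight of absence. The total thus consists of j + 1 equal
      terms.\<close>
    also have "\<dots> = real j * (v p * v p powr (- 1 / (real j + 1)))"
      using i by (simp add: v_def)
    also have "v p * v p powr (- 1 / (real j + 1)) = v p powr (real j / (real j + 1))"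
    proof -
      have "real j / (real j + 1) = 1 + (- 1 / (real j + 1))" by (simp add: field_simps)
      then show ?thesis using v[OF p] by (simp only: powr_add) simp
    qed
    finally show "(\<Sum>t\<in>T i p. h p t) = (real j + 1) * v p powr (real j / (real j + 1))"
      by (simp add: h_def algebra_simps)
  next
    fix x p assume x: "x \<in> U" and p: "p \<in> prime_factors n"
    define s where "s = slot (es x) p"
    have h_eq: "h p (f i x p) = (if s \<in> {i, j + 1} then v p powr (real j / (real j + 1))
        else v p powr (- 1 / (real j + 1)))" for i
      by (auto simp: h_def f_def s_def)
    have ge1: "v p powr (real j / (real j + 1)) \<ge> 1"
      using v[OF p] by (intro ge_one_powr_ge_zero) auto
    have "1 \<le> (\<Prod>i\<in>{..j}. h p (f i x p))"
    proof (cases "s = j + 1")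
      case True
      \<comment> \<open>An absent prime is seen as absent by every projection, so all factors are at
        least 1.\<close>
      then show ?thesis using ge1 by (intro prod_ge_1) (simp add: h_eq)
    next
      case False
      then have s: "s \<in> {..j}" using slot_le[OF x, of p] by (auto simp: s_def)
      \<comment> \<open>Only projection s forgets the slot s. Its large weight is cancelled exactly
        by the j small weights from the other projections.\<close>
      have "(\<Prod>i\<in>{..j}. h p (f i x p)) = h p (f s x p) * (\<Prod>i\<in>{..j} - {s}. h p (f i x p))"
        using s by (intro prod.remove) auto
      also have "(\<Prod>i\<in>{..j} - {s}. h p (f i x p)) =
          (\<Prod>i\<in>{..j} - {s}. v p powr (- 1 / (real j + 1)))"
        using False by (intro prod.cong) (auto simp: h_eq)
      also have "\<dots> = v p powr (- (real j / (real j + 1)))"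
        using s v[OF p] by (simp add: powr_power)
      also have "h p (f s x p) = v p powr (real j / (real j + 1))" by (simp add: h_eq)
      also have "\<dots> * v p powr (- (real j / (real j + 1))) = 1"
        using v[OF p] by (simp flip: powr_add)
      finally show ?thesis by simp
    qed
    then show "1 ^ card {..j} \<le> (\<Prod>i\<in>{..j}. h p (f i x p))" by simp
  qed auto
  then show ?thesis by (simp add: v_def)
qed

section \<open>The bound for strongly k-regular maps: merging neighbouring slots\<close>

lemma strongly_k_regular_card_le:
  assumes reg: "strongly_k_regular n j k U g" and n: "squarefree n" and j: "j \<ge> 1" and k: "k \<ge> 1"
  shows "real (card U) \<le> real k * ((real j + 2) / 2 powr (2 / (real j + 2))) ^ omega n"
proof -
  have n_pos: "n > 0" using n by (auto intro: Nat.gr0I)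
  note reg' = strongly_k_regularD[OF reg] n_pos
  define r where "r = j + 2"
  define es where "es x = x @ [g x]" for x
  \<comment> \<open>This is the (j + 2)-th root of 4, the geometric mean of two weights 2 and j
    weights 1.\<close>
  define b where "b = 2 powr (2 / (real j + 2))"
  define s where "s c = Suc c mod r" for c
  \<comment> \<open>The merge moves slot c onto its cyclic successor, so the value c is never taken.
    As n is squarefree, no exponents need to be recorded.\<close>
  define f where "f c x p = (if slot (es x) p = c then s c else slot (es x) p)" for c x p
  \<comment> \<open>The merged slot counts twice because it stands for two slots. With the j
    untouched slots the total is again j + 2.\<close>
  define h where "h c t = (if t = s c then 2 else 1 :: real)" for c t
  have len: "length (es x) = j + 1" and cop: "coprime_list (es x)"
    and dvd: "\<And>l. l \<le> j \<Longrightarrow> es x ! l dvd n" if "x \<in> U" for x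
    using that k_regularD[OF reg'] by (simp_all add: es_def)
  have s_lt: "s c < r" and s_neq: "s c \<noteq> c" if "c < r" for c
    using that by (auto simp: s_def r_def mod_Suc)
  have slot_lt: "slot (es x) p < r" if "x \<in> U" for x p
    using slot_le[of "es x" p] len[OF that] by (simp add: r_def)
  have dvd_iff: "p dvd es x ! l \<longleftrightarrow> slot (es x) p = l"
    if "x \<in> U" "p \<in> prime_factors n" "l \<le> j" for x p l
    using that cop len slot_eq_iff[of "es x" p l] by (auto simp: in_prime_factors_iff)
  have entry_eq: "es y ! l = es x ! l"
    if x: "x \<in> U" and y: "y \<in> U" and eq: "\<forall>p\<in>prime_factors n. f c y p = f c x p"
      and l: "l \<le> j" "l \<noteq> c" "l \<noteq> s c" for x y c l
  proof (rule eq_of_prime_factors_of_squarefree)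
    show "es y ! l dvd n" "es x ! l dvd n" using x y l dvd by auto
    then show "squarefree (es y ! l)" "squarefree (es x ! l)"
      using n by (auto intro: squarefree_mono)
    show "p dvd es y ! l \<longleftrightarrow> p dvd es x ! l" if p: "p \<in> prime_factors n" for p
      using bspec[OF eq p] l unfolding dvd_iff[OF x p l(1)] dvd_iff[OF y p l(1)]
      by (auto simp: f_def split: if_splits)
  qed (rule n_pos)
  \<comment> \<open>The merged slot shows which primes divide one of the two entries. Their product
    divides n because they are coprime, so it is squarefree and determined by those primes. For c =
    j - 1 the second factor is the value of g.\<close>
  have prod_eq: "es y ! c * es y ! Suc c = es x ! c * es x ! Suc c"
    if x: "x \<in> U" and y: "y \<in> U" and eq: "\<forall>p\<in>prime_factors n. f c y p = f c x p"
      and c: "c < j" for x y c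
  proof (rule eq_of_prime_factors_of_squarefree)
    have "es z ! c * es z ! Suc c dvd n" if "z \<in> U" for z
      using dvd[OF that] cop[OF that] len[OF that] c
      by (intro divides_mult) (auto simp: coprime_list_def)
    then show "es y ! c * es y ! Suc c dvd n" "es x ! c * es x ! Suc c dvd n"
      using x y by auto
    then show "squarefree (es y ! c * es y ! Suc c)" "squarefree (es x ! c * es x ! Suc c)"
      using n by (auto intro: squarefree_mono)
    have sc: "s c = Suc c" using c by (simp add: s_def r_def)
    show "p dvd es y ! c * es y ! Suc c \<longleftrightarrow> p dvd es x ! c * es x ! Suc c"
      if p: "p \<in> prime_factors n" for p
    proof -
      have "prime p" using p by (simp add: in_prime_factors_iff)
      then show ?thesis
        using bspec[OF eq p] dvd_iff[OF x p] dvd_iff[OF y p] c sc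
        by (auto simp: f_def prime_dvd_mult_iff split: if_splits)
    qed
  qed (rule n_pos)
  have "real (card U) * (\<Prod>p\<in>prime_factors n. b) \<le> real k * (\<Prod>p\<in>prime_factors n. real r)"
  proof (rule card_le_of_weighted_fibers[where I = "{..<r}" and f = f
        and T = "\<lambda>c _. {..<r} - {c}" and h = "\<lambda>c _. h c"])
    show "finite U" by (rule k_regular_finite[OF reg'])
    show "{..<r} \<noteq> {}" by (auto simp: r_def)
  next
    fix c x p assume "c \<in> {..<r}" "x \<in> U"
    then show "f c x p \<in> {..<r} - {c}"
      using slot_lt[of x p] s_lt[of c] s_neq[of c] by (auto simp: f_def)
  next
    fix c x assume c: "c \<in> {..<r}" and x: "x \<in> U"
    define A where "A = {y \<in> U. \<forall>p\<in>prime_factors n. f c y p = f c x p}"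
    have A: "A \<subseteq> U"
      and eqA: "\<And>y l. y \<in> A \<Longrightarrow> l \<le> j \<Longrightarrow> l \<noteq> c \<Longrightarrow> l \<noteq> s c \<Longrightarrow> es y ! l = es x ! l"
      and prodA: "\<And>y. y \<in> A \<Longrightarrow> c < j \<Longrightarrow> es y ! c * es y ! Suc c = es x ! c * es x ! Suc c"
      using entry_eq[OF x] prod_eq[OF x] by (auto simp: A_def)
    have es_nth: "es y ! l = y ! l" "es y ! j = g y" if "y \<in> U" "l < j" for y l
      using k_regular_length[OF reg' that(1)] that(2) by (simp_all add: es_def nth_append)
    have nth: "y ! l = x ! l" if "y \<in> A" "l < j" "l \<noteq> c" "l \<noteq> s c" for y l
      using eqA[of y l] that es_nth A x by (metis less_imp_le subsetD)
    have g_eq: "g y = g x" if "y \<in> A" "j \<noteq> c" "j \<noteq> s c" for y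
      using eqA[of y j] that es_nth(2)[of y 0] es_nth(2)[of x 0] j A x by auto
    \<comment> \<open>The position of the merge decides which bound applies. Absence with entry 0:
      only that entry is unknown, and g is known. The value with absence: only g is unknown, so the
      tuple is determined. The last entry with the value: their product is known, as in z * g = d.
      Two neighbouring entries: their product and g are known, which is the strong
      condition.\<close>
    consider "c = j + 1" | "c = j" | "Suc c = j" | "Suc c < j"
      using c by (force simp: r_def)
    then have "card A \<le> k"
    proof cases
      case 1
      then have sc: "s c = 0" by (simp add: s_def r_def)
      have "y ! l = x ! l" if "y \<in> A" "l < j" "l \<noteq> 0" for y l
        using nth[OF that(1,2)] that 1 sc by auto
      moreover have "\<forall>y\<in>A. g y = g x" using g_eq 1 sc j by auto
      ultimately show ?thesis using card_fiber_entry[OF reg' x _ A, of 0] j by auto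
    next
      case 2
      then have sc: "s c = j + 1" by (simp add: s_def r_def)
      have "A \<subseteq> {x}"
      proof
        fix y assume y: "y \<in> A"
        have "y = x"
        proof (rule nth_equalityI)
          show "length y = length x"
            using k_regular_length[OF reg', of y] k_regular_length[OF reg', of x] y A x by auto
          show "y ! l = x ! l" if "l < length y" for l
            using nth[OF y, of l] that k_regular_length[OF reg', of y] y A 2 sc by auto
        qed
        then show "y \<in> {x}" by simp
      qed
      then have "card A \<le> card {x}" by (intro card_mono) auto
      then show ?thesis using k by simp
    next
      case 3
      then have sc: "s c = j" by (simp add: s_def r_def)
      have "y ! l = x ! l" if "y \<in> A" "l < j" "l \<noteq> c" for y l
        using nth[OF that] that sc by auto
      moreover have "y ! c * g y = x ! c * g x" if "y \<in> A" for y
        using prodA[OF that] es_nth[of y c] es_nth[of x c] that A x 3 by auto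
      ultimately show ?thesis using card_fiber_entry[OF reg' x _ A, of c] 3 by auto
    next
      case 4
      then have sc: "s c = Suc c" by (simp add: s_def r_def)
      have "y ! l = x ! l" if "y \<in> A" "l < j" "l \<noteq> c" "l \<noteq> Suc c" for y l
        using nth[OF that(1-3)] that sc by auto
      moreover have "y ! c * y ! Suc c = x ! c * x ! Suc c" if "y \<in> A" for y
        using prodA[OF that] es_nth(1)[of y] es_nth(1)[of x] that A x 4 by auto
      moreover have "g y = g x" if "y \<in> A" for y
        using g_eq[OF that] 4 sc by auto
      ultimately show ?thesis
        using card_fiber_two_entries[OF reg n_pos x lessI 4 A] by auto
    qed
    then show "card {y \<in> U. \<forall>p\<in>prime_factors n. f c y p = f c x p} \<le> k" by (simp add: A_def)
  next
    show "h c t \<ge> 0" for c t by (simp add: h_def)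
    show "b \<ge> 0" by (simp add: b_def)
  next
    fix c assume c: "c \<in> {..<r}"
    have "(\<Sum>t\<in>{..<r} - {c}. h c t) = h c (s c) + (\<Sum>t\<in>{..<r} - {c} - {s c}. h c t)"
      using c s_lt s_neq by (intro sum.remove) auto
    also have "(\<Sum>t\<in>{..<r} - {c} - {s c}. h c t) = (\<Sum>t\<in>{..<r} - {c} - {s c}. 1)"
      by (intro sum.cong) (auto simp: h_def)
    also have "\<dots> = real j"
      using c s_lt[of c] s_neq[of c] by (simp add: r_def)
    finally show "(\<Sum>t\<in>{..<r} - {c}. h c t) = real r"
      by (simp add: h_def r_def)
  next
    fix x p assume x: "x \<in> U"
    define a where "a = slot (es x) p"
    \<comment> \<open>a is affected by the two merges with index a and a'.\<close>
    define a' where "a' = (if a = 0 then j + 1 else a - 1)"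
    have a: "a < r" using slot_lt[OF x] by (simp add: a_def)
    then have a': "a' < r" "a' \<noteq> a" "s a' = a"
      by (auto simp: a'_def r_def s_def)
    have h_ge: "h c t \<ge> 1" for c t by (simp add: h_def)
    have "b ^ r = 2 powr (2 / (real j + 2) * real r)"
      unfolding b_def by (simp add: powr_power mult.commute)
    also have "2 / (real j + 2) * real r = 2" by (simp add: r_def divide_eq_eq)
    also have "2 powr 2 = (4 :: real)" by simp
    \<comment> \<open>Merge a sends slot a to \<open>s a\<close>, and merge a' leaves it at a =
      \<open>s a'\<close>. Both images are merged slots and have weight 2.\<close>
    also have "4 = (\<Prod>c\<in>{a, a'}. h c (f c x p))"
      using a' by (auto simp: h_def f_def a_def)
    \<comment> \<open>The remaining merges contribute factors at least 1.\<close>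
    also have "\<dots> \<le> (\<Prod>c\<in>{..<r}. h c (f c x p))"
      using a a' h_ge by (intro prod_mono2) (auto intro: order_trans[OF zero_le_one])
    finally show "b ^ card {..<r} \<le> (\<Prod>c\<in>{..<r}. h c (f c x p))" by simp
  qed auto
  then have "real (card U) * b ^ omega n \<le> real k * (real j + 2) ^ omega n"
    by (simp add: omega_def r_def add.commute)
  moreover have "b > 0" by (simp add: b_def)
  ultimately show ?thesis
    by (simp add: b_def[symmetric] power_divide field_simps)
qed

section \<open>From individual maps to the attained maxima\<close>

theorem theorem2:
  fixes j k :: nat
  assumes "j \<ge> 1" and "k \<ge> 1"
  shows "(\<forall>n::nat. n \<ge> 1 \<and> squarefree n \<longrightarrow>
            real (E_star j k n)
              \<le> real k * ((real j + 2) / 2 powr (2 / (real j + 2))) ^ omega n) \<and>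
         (\<forall>n::nat. n \<ge> 1 \<longrightarrow>
            real (E j k n)
              \<le> real k * (\<Prod>p\<in>prime_factors n.
                   (real j + 1) * real (multiplicity p n) powr (real j / (real j + 1))))"
proof (intro conjI allI impI)
  fix n :: nat assume n: "n \<ge> 1 \<and> squarefree n"
  then have "E_star j k n \<in> {card U | U. \<exists>g. strongly_k_regular n j k U g}"
    unfolding E_star_def by (intro Max_in finite_E_star_set E_star_set_nonempty) auto
  then show "real (E_star j k n)
      \<le> real k * ((real j + 2) / 2 powr (2 / (real j + 2))) ^ omega n"
    using strongly_k_regular_card_le n assms by auto
next
  fix n :: nat assume n: "n \<ge> 1"
  then have "E j k n \<in> {card U | U. \<exists>g. k_regular n j k U g}"
    unfolding E_def by (intro Max_in finite_E_set E_set_nonempty) auto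
  then obtain U g where "E j k n = card U" "k_regular n j k U g" by auto
  then show "real (E j k n) \<le> real k * (\<Prod>p\<in>prime_factors n.
      (real j + 1) * real (multiplicity p n) powr (real j / (real j + 1)))"
    using k_regular_card_le[of n j k U g] n assms by auto
qed

end
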